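(* Let $0<d<\pi$ and assume that $f$ is analytic in $\phi(\mathscr{D}_d)$ and that there exist positive constants $K$, $\alpha$, $\beta$ such that $$|f(z)|\leq K\left|\frac{z}{1+z}\right|^{\alpha}\left|\mathrm{e}^{-z}\right|^{\beta}$$ holds for all $z\in\phi(\mathscr{D}_d)$. Let $\mu=\min\{\alpha,\beta\}$, let $n$ be a positive integer, let $M$ and $N$ be defined by $$\begin{cases} M=n,\quad N=\lceil \alpha n/\beta\rceil & (\text{if } \mu=\alpha),\\ N=n,\quad M=\lceil \beta n/\alpha\rceil & (\text{if } \mu=\beta),\end{cases}$$ and let $h=\sqrt{\dfrac{\pi d}{\mu n}}$. Then $$\sup_{t\in(0,\infty)}\left| f(t)-\sum_{k=-M}^{N} f(\phi(kh))\,S(k,h)(\phi^{-1}(t))\right|\leq C\sqrt{n}\,\mathrm{e}^{-\sqrt{\pi d\mu n}},$$ where $C$ is the constant given by $$C=\frac{2K}{\sqrt{\pi d\mu}}\left\{\frac{2}{\sqrt{\pi d\mu}\,(1-\mathrm{e}^{-2\sqrt{\pi d\mu}})\{\cos(d/2)\}^{\alpha+\beta}}\left(\frac{\mathrm{e}}{\mathrm{e}-1}\right)^{\mu/2}+1\right\}.$$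
   Context: For $d>0$, $\mathscr{D}_d=\{\zeta\in\mathbb{C}:|\operatorname{Im}\zeta|<d\}$. The map $\phi(\zeta)=\log(1+\mathrm{e}^{\zeta})$ (principal branch of the logarithm) is a conformal map on $\mathscr{D}_d$ for $0<d<\pi$; it maps $(-\infty,\infty)$ bijectively onto $(0,\infty)$, and $\phi^{-1}(t)=\log(\mathrm{e}^t-1)$ for $t\in(0,\infty)$. $\phi(\mathscr{D}_d)$ denotes the image of $\mathscr{D}_d$ under $\phi$. The Sinc function is $S(k,h)(x)=\dfrac{\sin[\pi(x/h-k)]}{\pi(x/h-k)}$ (with value $1$ at $x=kh$). *)

theory Defs
  imports "HOL-Analysis.Analysis"
begin

definition strip :: "real \<Rightarrow> complex set" where
  "strip d = {\<zeta>. \<bar>Im \<zeta>\<bar> < d}"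

definition phi :: "complex \<Rightarrow> complex" where
  "phi \<zeta> = Ln (1 + exp \<zeta>)"

text \<open>The inverse of \<^const>\<open>phi\<close> restricted to the real line; meaningful for \<open>t > 0\<close>.\<close>

definition phi_inv :: "real \<Rightarrow> real" where
  "phi_inv t = ln (exp t - 1)"

definition sinc_basis :: "int \<Rightarrow> real \<Rightarrow> real \<Rightarrow> real" where
  "sinc_basis k h x =
    (if x = of_int k * h then 1
     else sin (pi * (x / h - of_int k)) / (pi * (x / h - of_int k)))"

end

(* In the variable zeta = phi^-1(z) the function g = f o phi lives on a strip, and decays there like
   exp (- mu |Re zeta|): for w = phi(zeta) one has |1 + exp zeta| >= (1 + exp (Re zeta)) cos (Im zeta / 2)
   and |w / (1 + w)| <= 1 / ((1 + exp (- Re zeta)) cos (Im zeta / 2)).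
   The error of the symmetric partial sums of the cardinal series of g is, up to the factor
   sin (pi x / h) / (2 pi i), the integral of g(zeta) / ((zeta - x) sin (pi zeta / h)) over a rectangle.
   Its vertical sides contribute nothing in the limit, and its horizontal sides are bounded by the
   decay of g and by |sin (pi zeta / h)| >= sinh (pi |Im zeta| / h). The terms of the series that
   are left out form geometric tails. The choice of h, M and N balances the two errors. *)

theory Submission
  imports Defs "HOL-Complex_Analysis.Complex_Analysis"
begin

section \<open>Decay of the transformed function\<close>

text \<open>A real value forces \<open>sin y = 0\<close>, hence \<open>y = 0\<close> when
  \<open>|y| < pi\<close>, and there \<open>1 + exp x\<close> is positive. This keeps the argument
  of \<open>Ln\<close> off the branch cut, and away from zero, on the whole strip.\<close>

lemma one_plus_exp_not_nonpos:
  fixes x y :: real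
  assumes "\<bar>y\<bar> < pi"
  shows "1 + exp (Complex x y) \<notin> \<real>\<^sub>\<le>\<^sub>0"
proof
  assume neg: "1 + exp (Complex x y) \<in> \<real>\<^sub>\<le>\<^sub>0"
  then have im: "sin y = 0" and re: "1 + exp x * cos y \<le> 0"
    by (auto simp: complex_nonpos_Reals_iff Re_exp Im_exp)
  have "- pi < y" "y < pi" using assms by auto
  then have "y = 0" using im by (rule sin_eq_0_pi)
  with re show False using exp_gt_zero[of x] by simp
qed

lemma phi_holomorphic_on_strip:
  assumes "d \<le> pi"
  shows "phi holomorphic_on strip d"
proof -
  have "1 + exp z \<notin> \<real>\<^sub>\<le>\<^sub>0" if "z \<in> strip d" for z
    using one_plus_exp_not_nonpos[of "Im z" "Re z"] that assms by (simp add: strip_def)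
  then show ?thesis unfolding phi_def by (auto intro!: holomorphic_intros)
qed

lemma cos_half_pos:
  fixes y :: real
  assumes "\<bar>y\<bar> < pi"
  shows "0 < cos (y / 2)"
  using assms by (intro cos_gt_zero_pi) auto

text \<open>By the half-angle formula the squared norm is
  \<open>((1 + r) cos (y/2))^2 + ((1 - r) sin (y/2))^2\<close>; the second square is dropped, so the
  bound is sharp at \<open>r = 1\<close>.\<close>

lemma norm_one_plus_cis_ge:
  fixes r y :: real
  assumes "0 \<le> r"
  shows "(1 + r) * cos (y / 2) \<le> norm (1 + of_real r * cis y)"
proof -
  have cy: "cos y = 2 * (cos (y / 2))\<^sup>2 - 1"
    using cos_double_cos[of "y / 2"] by simp
  have "(norm (1 + of_real r * cis y))\<^sup>2 = (1 + r * cos y)\<^sup>2 + (r * sin y)\<^sup>2"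
    by (simp add: cmod_power2)
  also have "\<dots> = 1 + 2 * r * cos y + r\<^sup>2"
    using sin_cos_squared_add[of y] by algebra
  also have "\<dots> = ((1 + r) * cos (y / 2))\<^sup>2 + (1 - r)\<^sup>2 * (sin (y / 2))\<^sup>2"
    unfolding cy using sin_cos_squared_add[of "y / 2"] by algebra
  finally have "((1 + r) * cos (y / 2))\<^sup>2 \<le> (norm (1 + of_real r * cis y))\<^sup>2" by simp
  then show ?thesis by (rule power2_le_imp_le) simp
qed

text \<open>Since \<open>exp (- phi z)\<close> is the reciprocal of \<open>1 + exp z\<close>, the
  half-angle bound with \<open>r = exp x\<close> applies. This controls the factor that carries the
  exponent \<beta>.\<close>

lemma norm_exp_minus_phi_le:
  fixes x y :: real
  assumes "\<bar>y\<bar> < pi"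
  shows "norm (exp (- phi (Complex x y))) \<le> 1 / ((1 + exp x) * cos (y / 2))"
proof -
  have nz: "1 + exp (Complex x y) \<noteq> 0"
    using one_plus_exp_not_nonpos[OF assms, of x] by auto
  have "exp (Complex x y) = of_real (exp x) * cis y"
    by (simp add: exp_eq_polar)
  then have ge: "(1 + exp x) * cos (y / 2) \<le> norm (1 + exp (Complex x y))"
    using norm_one_plus_cis_ge[of "exp x" y] by simp
  have "0 < (1 + exp x) * cos (y / 2)"
    using cos_half_pos[OF assms] by (simp add: add_pos_pos)
  moreover have "norm (exp (- phi (Complex x y))) = 1 / norm (1 + exp (Complex x y))"
    using nz by (simp add: phi_def exp_minus norm_inverse divide_inverse)
  ultimately show ?thesis using ge by (simp add: frac_le)
qed

text \<open>With \<open>w = Ln (1 + r e\<^sup>i\<^sup>y)\<close> and \<open>s = ln (1 + \<tau> r)\<close>, the derivative of \<open>w\<close> in \<open>s\<close> has a reciprocal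
  on the chord between \<open>1\<close> and \<open>e\<^sup>-\<^sup>i\<^sup>y\<close>, so it moves on the circle with centre
  \<open>e\<^sup>i\<^sup>y\<^sup>/\<^sup>2 / (2 cos (y/2))\<close> through the origin.\<close>

lemma phi_in_disc:
  fixes x y :: real
  assumes "\<bar>y\<bar> < pi"
  defines "L \<equiv> ln (1 + exp x)" and "c \<equiv> cos (y / 2)"
  shows "norm (phi (Complex x y) - of_real (L / (2 * c)) * cis (y / 2)) \<le> L / (2 * c)"
proof -
  have c: "0 < c" using cos_half_pos[OF assms(1)] by (simp add: c_def)
  have L: "0 < L" unfolding L_def by (intro ln_gt_zero) simp
  define m where "m = of_real (1 / (2 * c)) * cis (y / 2)"
  \<comment> \<open>The parameter \<open>s\<close> runs from \<open>0\<close> to \<open>L\<close>,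
    and \<open>s * m\<close> is a centre moving with constant velocity. As \<open>H 0 = 0\<close>
    and \<open>H L\<close> is the difference to be bounded, it suffices that the speed is at most
    \<open>1 / (2 * c)\<close>.\<close>
  define H where "H s = Ln (1 + of_real (exp s - 1) * cis y) - of_real s * m" for s :: real
  define D where "D s = of_real (exp s) * cis y / (1 + of_real (exp s - 1) * cis y) - m" for s :: real
  have nonneg: "1 + of_real (exp s - 1) * cis y \<notin> \<real>\<^sub>\<le>\<^sub>0" if "0 \<le> s" for s
  proof (cases "s = 0")
    case False
    then have "of_real (exp s - 1) * cis y = exp (Complex (ln (exp s - 1)) y)"
      using that by (simp add: exp_eq_polar)
    then show ?thesis using one_plus_exp_not_nonpos[OF assms(1)] by metis
  qed auto
  have der: "(H has_vector_derivative D s) (at s within {0..L})" if "s \<in> {0..L}" for s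
  proof -
    have 1: "((\<lambda>z. Ln (1 + (exp z - 1) * cis y) - z * m) has_field_derivative
        (exp (of_real s) * cis y / (1 + (exp (of_real s) - 1) * cis y) - m)) (at (of_real s))"
      using nonneg[of s] that
      by (auto intro!: derivative_eq_intros simp: divide_inverse exp_of_real)
    have "((\<lambda>s. Ln (1 + (exp (of_real s) - 1) * cis y) - of_real s * m) has_vector_derivative D s) 
        (at s within {0..L})"
      using has_vector_derivative_real_field[OF 1] by (simp add: D_def exp_of_real)
    then show ?thesis unfolding H_def [abs_def] by (simp add: exp_of_real)
  qed
  have bound: "norm (D s) \<le> 1 / (2 * c)" if "s \<in> {0..L}" for s
  proof -
    define q where "q = 1 + of_real (exp s - 1) * cis y"
    have q: "q \<noteq> 0" using nonneg[of s] that by (auto simp: q_def)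
    have cy: "cis y = cis (y / 2) * cis (y / 2)" by (simp add: cis_mult)
    have cc: "2 * of_real c = cis (y/2) + cis (- y/2)"
      by (simp add: complex_eq_iff c_def)
    have inv: "cis (y/2) * cis (- y/2) = 1" by (simp add: cis_mult)
    have "D s = (2 * of_real c * of_real (exp s) * cis y - cis (y/2) * q) / (2 * of_real c * q)"
    proof -
      have "D s = of_real (exp s) * cis y / q - of_real (1 / (2 * c)) * cis (y / 2)"
        by (simp add: D_def m_def q_def)
      then show ?thesis using q c by (simp add: field_simps)
    qed
    \<comment> \<open>The numerator is a unimodular number times the conjugate of \<open>q\<close>,
      so its norm cancels against that of \<open>q\<close> and the speed is exactly
      \<open>1 / (2 * c)\<close>.\<close>
    also have "2 * of_real c * of_real (exp s) * cis y - cis (y/2) * q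
        = cis (3 * y / 2) * (1 + of_real (exp s - 1) * cis (- y))"
    proof -
      have 3: "cis (3 * y / 2) = cis (y/2) * cis (y/2) * cis (y/2)" by (simp add: cis_mult)
      have 4: "cis (- y) = cis (-y/2) * cis (-y/2)" by (simp add: cis_mult)
      show ?thesis unfolding cc 3 4 q_def cy using inv by simp algebra
    qed
    also have "1 + of_real (exp s - 1) * cis (- y) = cnj q"
      by (simp add: q_def cis_cnj)
    finally have "norm (D s) = norm (cis (3 * y / 2) * cnj q / (2 * of_real c * q))" by simp
    also have "\<dots> = 1 / (2 * c)" using q c by (simp add: norm_divide norm_mult)
    finally show ?thesis by simp
  qed
  have "norm (H L - H 0) \<le> 1 / (2 * c) * norm (L - 0)"
  proof (rule differentiable_bound[of "{0..L}" H "\<lambda>s h. h *\<^sub>R D s"])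
    show "onorm (\<lambda>h. h *\<^sub>R D s) \<le> 1 / (2 * c)" if "s \<in> {0..L}" for s
    proof (rule onorm_le)
      show "norm (t *\<^sub>R D s) \<le> 1 / (2 * c) * norm t" for t
        using mult_left_mono[OF bound[OF that], of "\<bar>t\<bar>"] by simp
    qed
  qed (use der L in \<open>auto simp: has_vector_derivative_def\<close>)
  moreover have "H L = phi (Complex x y) - of_real (L / (2 * c)) * cis (y / 2)"
  proof -
    have "exp L = 1 + exp x" by (simp add: L_def add_pos_pos)
    then have "of_real (exp L - 1) * cis y = exp (Complex x y)" by (simp add: exp_eq_polar)
    then show ?thesis by (simp add: H_def phi_def m_def)
  qed
  ultimately show ?thesis using L by (simp add: H_def)
qed

text \<open>Rotating \<open>w\<close> by \<open>cis (- y / 2)\<close> gives a point \<open>u\<close>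
  in a disc with real centre whose boundary passes through the origin, which bounds
  \<open>Re u\<close> below by \<open>c |w|^2 / L\<close>. The real part of
  \<open>cis (y/2) * cnj w * (1 + w)\<close> is \<open>Re u + c |w|^2\<close>, and it is at most
  \<open>|w| |1 + w|\<close>; dividing by \<open>|w|\<close> bounds the ratio.\<close>

lemma norm_phi_ratio_le:
  fixes x y :: real
  assumes "\<bar>y\<bar> < pi"
  defines "w \<equiv> phi (Complex x y)"
  shows "norm (w / (1 + w)) \<le> 1 / ((1 + exp (- x)) * cos (y / 2))"
proof (cases "w = 0")
  case True
  then show ?thesis using cos_half_pos[OF assms(1)] by (simp add: add_nonneg_nonneg)
next
  case False
  define L c where "L = ln (1 + exp x)" and "c = cos (y / 2)"
  have c: "0 < c" using cos_half_pos[OF assms(1)] by (simp add: c_def)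
  have L: "0 < L" unfolding L_def by (intro ln_gt_zero) simp
  define u where "u = w * cis (- y / 2)"
  have nu: "norm u = norm w" by (simp add: u_def norm_mult)
  have "norm (u - of_real (L / (2 * c))) = norm ((u - of_real (L / (2 * c))) * cis (y / 2))"
    by (simp add: norm_mult)
  also have "(u - of_real (L / (2 * c))) * cis (y / 2) = w - of_real (L / (2 * c)) * cis (y / 2)"
    by (simp add: u_def algebra_simps cis_mult)
  finally have "norm (u - of_real (L / (2 * c))) \<le> L / (2 * c)"
    using phi_in_disc[OF assms(1), of x] by (simp add: w_def L_def c_def)
  then have "(norm (u - of_real (L / (2 * c))))\<^sup>2 \<le> (L / (2 * c))\<^sup>2"
    by (intro power_mono) auto
  \<comment> \<open>In the expanded squares the radius cancels, because it equals the centre; only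
    twice the centre times \<open>Re u\<close> remains.\<close>
  then have "(norm w)\<^sup>2 \<le> L / c * Re u"
    unfolding nu[symmetric] cmod_power2
    by (simp add: power2_eq_square algebra_simps)
  then have 1: "c * (norm w)\<^sup>2 / L \<le> Re u" using L c by (simp add: field_simps)
  have "Re u + c * (norm w)\<^sup>2 = Re (cis (y / 2) * (cnj w * (1 + w)))"
    unfolding cmod_power2 by (simp add: u_def c_def algebra_simps power2_eq_square)
  also have "\<dots> \<le> norm (cis (y / 2) * (cnj w * (1 + w)))" by (rule complex_Re_le_cmod)
  also have "\<dots> = norm w * norm (1 + w)" by (simp add: norm_mult)
  finally have "c * (norm w)\<^sup>2 / L + c * (norm w)\<^sup>2 \<le> norm w * norm (1 + w)"
    using 1 by linarith
  then have "norm w * (c * norm w * (1 / L + 1)) \<le> norm w * norm (1 + w)"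
    by (simp add: power2_eq_square algebra_simps)
  then have 2: "c * norm w * (1 / L + 1) \<le> norm (1 + w)"
    using False by simp
  \<comment> \<open>The inequality \<open>ln (1 + e) \<le> e\<close> with \<open>e = exp x\<close>
    trades \<open>1 / L\<close> for \<open>exp (- x)\<close>.\<close>
  have "L \<le> exp x" unfolding L_def by (intro ln_add_one_self_le_self) simp
  then have "exp (- x) \<le> 1 / L" using L by (simp add: exp_minus field_simps)
  then have "c * norm w * (1 + exp (- x)) \<le> c * norm w * (1 / L + 1)"
    using c by (intro mult_left_mono) auto
  with 2 have 3: "norm w * ((1 + exp (- x)) * c) \<le> norm (1 + w)" by (simp add: mult_ac)
  have pos: "0 < (1 + exp (- x)) * c" using c by (simp add: add_pos_pos)
  moreover have "0 < norm (1 + w)" 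
    using 3 False pos by (smt (verit) mult_pos_pos zero_less_norm_iff)
  ultimately show ?thesis using 3 by (simp add: norm_divide field_simps c_def)
qed

section \<open>Estimates on a rectangle\<close>

text \<open>An integrable majorant replaces the estimate by length times supremum, which would grow
  with the width of the rectangle. An affine substitution moves the majorant to the unit interval on
  which \<open>linepath\<close> is parametrized.\<close>

lemma norm_contour_integral_horizontal_le:
  fixes f :: "complex \<Rightarrow> complex"
  assumes int: "f contour_integrable_on linepath (Complex a y) (Complex b y)"
    and "a < b" and G: "(G has_integral I) {a..b}"
    and le: "\<And>t. t \<in> {a..b} \<Longrightarrow> norm (f (Complex t y)) \<le> G t"
  shows "norm (contour_integral (linepath (Complex a y) (Complex b y)) f) \<le> I"
proof -
  define J where "J = contour_integral (linepath (Complex a y) (Complex b y)) f"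
  have path: "linepath (Complex a y) (Complex b y) u = Complex (a + u * (b - a)) y" for u
    by (simp add: linepath_def complex_eq_iff algebra_simps)
  have diff: "Complex b y - Complex a y = of_real (b - a)" by (simp add: complex_eq_iff)
  have "(f has_contour_integral J) (linepath (Complex a y) (Complex b y))"
    unfolding J_def using int by (rule has_contour_integral_integral)
  then have 1: "((\<lambda>u. f (Complex (a + u * (b - a)) y) * of_real (b - a)) has_integral J) {0..1}"
    by (simp only: has_contour_integral_linepath path diff)
  have "((\<lambda>u. G ((b - a) *\<^sub>R u + a)) has_integral (I /\<^sub>R (b - a) ^ DIM(real)))
      (cbox ((a - a) /\<^sub>R (b - a)) ((b - a) /\<^sub>R (b - a)))"
    using G \<open>a < b\<close> by (intro has_integral_affinity') auto
  then have "((\<lambda>u. G (a + u * (b - a))) has_integral (I / (b - a))) {0..1}"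
    using \<open>a < b\<close> by (simp add: divide_inverse mult_ac add_ac)
  from has_integral_mult_left[OF this, of "b - a"]
  have 2: "((\<lambda>u. G (a + u * (b - a)) * (b - a)) has_integral I) {0..1}"
    using \<open>a < b\<close> by simp
  have "norm (f (Complex (a + u * (b - a)) y) * of_real (b - a)) \<le> G (a + u * (b - a)) * (b - a)"
    if "u \<in> {0..1}" for u
  proof -
    have "u * (b - a) \<le> 1 * (b - a)" "0 \<le> u * (b - a)" using that \<open>a < b\<close> by (auto intro!: mult_right_mono)
    then have "a + u * (b - a) \<in> {a..b}" by auto
    from le[OF this] show ?thesis 
      using \<open>a < b\<close> by (simp only: norm_mult norm_of_real) (auto intro!: mult_right_mono)
  qed
  then have "norm (integral {0..1} (\<lambda>u. f (Complex (a + u * (b - a)) y) * of_real (b - a)))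
      \<le> integral {0..1} (\<lambda>u. G (a + u * (b - a)) * (b - a))"
    using 1 2 by (intro integral_norm_bound_integral) auto
  then show ?thesis using integral_unique[OF 1] integral_unique[OF 2] by (simp add: J_def)
qed

text \<open>Each horizontal side costs the integral of the majorant \<open>G\<close>, and each
  vertical side its length \<open>2 * \<delta>\<close> times the supremum bound
  \<open>V\<close>.\<close>

lemma norm_contour_integral_rectpath_le:
  fixes f :: "complex \<Rightarrow> complex"
  assumes cont: "continuous_on (path_image (rectpath (Complex (- X) (- \<delta>)) (Complex X \<delta>))) f"
    and "0 < X" and "0 < \<delta>" and "0 \<le> V"
    and G: "(G has_integral I) {- X..X}"
    and horiz: "\<And>t. t \<in> {- X..X} \<Longrightarrow> norm (f (Complex t \<delta>)) \<le> G t"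
      "\<And>t. t \<in> {- X..X} \<Longrightarrow> norm (f (Complex t (- \<delta>))) \<le> G t"
    and vert: "\<And>t. t \<in> {- \<delta>..\<delta>} \<Longrightarrow> norm (f (Complex X t)) \<le> V"
      "\<And>t. t \<in> {- \<delta>..\<delta>} \<Longrightarrow> norm (f (Complex (- X) t)) \<le> V"
  shows "norm (contour_integral (rectpath (Complex (- X) (- \<delta>)) (Complex X \<delta>)) f) \<le> 2 * I + 4 * \<delta> * V"
proof -
  let ?a = "Complex (- X) (- \<delta>)" and ?b = "Complex X (- \<delta>)"
    and ?c = "Complex X \<delta>" and ?e = "Complex (- X) \<delta>"
  have img: "path_image (rectpath ?a ?c) = closed_segment ?a ?b \<union> closed_segment ?b ?c \<union>
      closed_segment ?c ?e \<union> closed_segment ?e ?a"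
    by (simp add: rectpath_def Let_def path_image_join Un_assoc)
  have int: "f contour_integrable_on linepath ?a ?b" "f contour_integrable_on linepath ?b ?c"
    "f contour_integrable_on linepath ?c ?e" "f contour_integrable_on linepath ?e ?a"
    using cont unfolding img
    by (auto intro!: contour_integrable_continuous_linepath elim!: continuous_on_subset)
  have split: "contour_integral (rectpath ?a ?c) f = contour_integral (linepath ?a ?b) f +
     (contour_integral (linepath ?b ?c) f + (contour_integral (linepath ?c ?e) f +
      contour_integral (linepath ?e ?a) f))"
    using int by (simp add: rectpath_def Let_def contour_integral_join)
  have h1: "norm (contour_integral (linepath ?a ?b) f) \<le> I"
    using int(1) \<open>0 < X\<close> G horiz(2) by (intro norm_contour_integral_horizontal_le[where G = G]) auto
  \<comment> \<open>The top side is traversed from right to left; it is reversed because the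
    horizontal estimate asks for \<open>a < b\<close>.\<close>
  have rev: "contour_integral (linepath ?c ?e) f = - contour_integral (linepath ?e ?c) f"
    by (metis contour_integral_reversepath reversepath_linepath valid_path_linepath)
  have "f contour_integrable_on linepath ?e ?c"
    using int(3) by (metis contour_integrable_reversepath reversepath_linepath valid_path_linepath)
  then have h2: "norm (contour_integral (linepath ?c ?e) f) \<le> I"
    unfolding rev norm_minus_cancel
    using \<open>0 < X\<close> G horiz(1) by (intro norm_contour_integral_horizontal_le[where G = G]) auto
  have n: "norm (?c - ?b) = 2 * \<delta>" "norm (?a - ?e) = 2 * \<delta>"
  proof -
    have "?c - ?b = of_real (2 * \<delta>) * \<i>" "?a - ?e = - (of_real (2 * \<delta>) * \<i>)"
      by (simp_all add: complex_eq_iff)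
    then have "norm (?c - ?b) = \<bar>2 * \<delta>\<bar>" "norm (?a - ?e) = \<bar>2 * \<delta>\<bar>"
      by (simp_all only: norm_minus_cancel norm_mult norm_of_real norm_ii mult_1_right)
    then show "norm (?c - ?b) = 2 * \<delta>" "norm (?a - ?e) = 2 * \<delta>"
      using \<open>0 < \<delta>\<close> by simp_all
  qed
  have v1: "norm (contour_integral (linepath ?b ?c) f) \<le> V * norm (?c - ?b)"
  proof (rule contour_integral_bound_linepath[OF int(2) \<open>0 \<le> V\<close>])
    fix z assume "z \<in> closed_segment ?b ?c"
    then have "Re z = X" "Im z \<in> {- \<delta>..\<delta>}"
      using \<open>0 < \<delta>\<close> by (auto simp: closed_segment_same_Re closed_segment_eq_real_ivl)
    then show "norm (f z) \<le> V" using vert(1)[of "Im z"] by (metis complex_surj)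
  qed
  have v2: "norm (contour_integral (linepath ?e ?a) f) \<le> V * norm (?a - ?e)"
  proof (rule contour_integral_bound_linepath[OF int(4) \<open>0 \<le> V\<close>])
    fix z assume "z \<in> closed_segment ?e ?a"
    then have "Re z = - X" "Im z \<in> {- \<delta>..\<delta>}"
      using \<open>0 < \<delta>\<close> by (auto simp: closed_segment_same_Re closed_segment_eq_real_ivl)
    then show "norm (f z) \<le> V" using vert(2)[of "Im z"] by (metis complex_surj)
  qed
  have "norm (contour_integral (rectpath ?a ?c) f) \<le> I + (V * (2 * \<delta>) + (I + V * (2 * \<delta>)))"
    unfolding split by (intro norm_triangle_mono h1 h2 v1[unfolded n] v2[unfolded n])
  then show ?thesis by (simp add: algebra_simps)
qed

lemma has_integral_exp_minus_abs:
  fixes \<mu> X :: real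
  assumes "0 < \<mu>" "0 \<le> X"
  shows "((\<lambda>t. exp (- \<mu> * \<bar>t\<bar>)) has_integral 2 * (1 - exp (- \<mu> * X)) / \<mu>) {- X..X}"
proof -
  have "((\<lambda>t. exp (\<mu> * t)) has_integral exp (\<mu> * 0) / \<mu> - exp (\<mu> * - X) / \<mu>) {- X..0}"
    using assms by (intro fundamental_theorem_of_calculus)
      (auto intro!: derivative_eq_intros simp flip: has_real_derivative_iff_has_vector_derivative)
  then have l: "((\<lambda>t. exp (- \<mu> * \<bar>t\<bar>)) has_integral exp (\<mu> * 0) / \<mu> - exp (\<mu> * - X) / \<mu>) {- X..0}"
    by (rule has_integral_eq[rotated]) auto
  have "((\<lambda>t. exp (- \<mu> * t)) has_integral - exp (- \<mu> * X) / \<mu> - - exp (- \<mu> * 0) / \<mu>) {0..X}"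
    using assms by (intro fundamental_theorem_of_calculus)
      (auto intro!: derivative_eq_intros simp flip: has_real_derivative_iff_has_vector_derivative)
  then have r: "((\<lambda>t. exp (- \<mu> * \<bar>t\<bar>)) has_integral - exp (- \<mu> * X) / \<mu> - - exp (- \<mu> * 0) / \<mu>) {0..X}"
    by (rule has_integral_eq[rotated]) auto
  have "2 * (1 - exp (- \<mu> * X)) / \<mu> = (exp (\<mu> * 0) / \<mu> - exp (\<mu> * - X) / \<mu>)
      + (- exp (- \<mu> * X) / \<mu> - - exp (- \<mu> * 0) / \<mu>)"
    by (simp add: diff_divide_distrib)
  then show ?thesis using has_integral_combine[OF _ _ l r] assms by simp
qed

text \<open>In \<open>norm_sin_squared\<close> the cosine is replaced by its maximum
  \<open>1\<close>, which leaves the square of \<open>sinh (Im z)\<close>. This serves the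
  horizontal sides.\<close>

lemma sinh_le_norm_sin:
  fixes z :: complex
  shows "sinh \<bar>Im z\<bar> \<le> norm (sin z)"
proof -
  define E where "E = exp (Im z)"
  have E: "0 < E" by (simp add: E_def)
  have "(sinh \<bar>Im z\<bar>)\<^sup>2 = (sinh (Im z))\<^sup>2" by (simp add: abs_if)
  also have "\<dots> = ((E - inverse E) / 2)\<^sup>2" by (simp add: sinh_def E_def exp_minus)
  also have "\<dots> = (E\<^sup>2 + inverse (E\<^sup>2) - 2) / 4"
    using E by (simp add: field_simps power2_eq_square)
  also have "\<dots> \<le> (norm (sin z))\<^sup>2"
    unfolding norm_sin_squared by (simp add: E_def exp_double[symmetric])
  finally show ?thesis by (rule power2_le_imp_le) simp
qed

text \<open>The hypothesis places \<open>z\<close> on a vertical line halfway between consecutive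
  zeros of the sine. There the norm is \<open>cosh (Im z)\<close>, and \<open>a + 1/a\<close> is at
  least \<open>2\<close>. This serves the vertical sides.\<close>

lemma one_le_norm_sin:
  fixes z :: complex
  assumes "cos (2 * Re z) = - 1"
  shows "1 \<le> norm (sin z)"
proof -
  define a where "a = exp (2 * Im z)"
  have a: "0 < a" by (simp add: a_def)
  have "0 \<le> (a - 1)\<^sup>2" by simp
  then have "2 \<le> a + inverse a"
    using a by (simp add: field_simps power2_eq_square)
  then have "1\<^sup>2 \<le> (norm (sin z))\<^sup>2"
    unfolding norm_sin_squared using assms by (simp add: a_def)
  then show ?thesis by (rule power2_le_imp_le) simp
qed

section \<open>The contour integral for the sinc interpolation error\<close>

lemma sinc_basis_node:
  assumes "h \<noteq> 0"
  shows "sinc_basis k h (of_int j * h) = (if k = j then 1 else 0)"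
proof -
  have "sin (pi * of_int (j - k)) = 0" by (rule sin_npi_int)
  then show ?thesis using assms by (auto simp: sinc_basis_def)
qed

lemma abs_sinc_basis_le_1: "\<bar>sinc_basis k h x\<bar> \<le> 1"
proof -
  have "\<bar>sin u / u\<bar> \<le> 1" for u :: real
    using abs_sin_x_le_abs_x[of u] by (cases "u = 0") (auto simp: field_simps)
  then show ?thesis by (simp add: sinc_basis_def)
qed

text \<open>The sign \<open>(-1)^k\<close> is carried as \<open>cos (pi * of_int k)\<close>, the
  form in which the derivative of the sine at a node delivers it.\<close>

lemma sin_pi_diff_int:
  fixes u :: real
  shows "sin (pi * (u - of_int k)) = sin (pi * u) * cos (pi * of_int k)"
  unfolding right_diff_distrib sin_diff sin_npi_int by simp

lemma cos_pi_int_squared: "(cos (pi * of_int k))\<^sup>2 = (1::real)"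
  unfolding cos_squared_eq sin_npi_int by simp

text \<open>The sine has a simple zero at the node, so its quotient by \<open>w - p\<close> tends to
  its derivative there, \<open>pi / h\<close> times a sign. The limit form is the one from which a
  residue at a simple pole is read off.\<close>

lemma sinc_residue_tendsto:
  fixes g :: "complex \<Rightarrow> complex" and h x :: real and k :: int
  assumes "0 < h" and "isCont g (of_real (of_int k * h))" and "x \<noteq> of_int k * h"
  shows "((\<lambda>w. g w / ((w - of_real x) * sin (of_real (pi / h) * w)) * (w - of_real (of_int k * h)))
     \<longlongrightarrow> g (of_real (of_int k * h)) / of_real ((of_int k * h - x) * (pi / h * cos (pi * of_int k))))
     (at (of_real (of_int k * h)))"
proof -
  define p :: complex where "p = of_real (of_int k * h)"
  have arg: "of_real (pi / h) * p = of_real (pi * of_int k)" using \<open>0 < h\<close> by (simp add: p_def)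
  have s0: "sin (of_real (pi / h) * p) = 0"
    unfolding arg sin_of_real sin_npi_int by simp
  have cosp: "of_real (pi / h) * cos (of_real (pi / h) * p) = of_real (pi / h * cos (pi * of_int k))"
    unfolding arg by (simp only: cos_of_real of_real_mult[symmetric])
  have "((\<lambda>w. sin (of_real (pi / h) * w)) has_field_derivative
      of_real (pi / h) * cos (of_real (pi / h) * p)) (at p)"
    by (rule derivative_eq_intros refl | simp add: mult.commute)+
  then have "((\<lambda>w. (sin (of_real (pi / h) * w) - sin (of_real (pi / h) * p)) / (w - p)) \<longlongrightarrow>
      of_real (pi / h * cos (pi * of_int k))) (at p)"
    unfolding has_field_derivative_iff cosp .
  then have lim: "((\<lambda>w. sin (of_real (pi / h) * w) / (w - p)) \<longlongrightarrow>
      of_real (pi / h * cos (pi * of_int k))) (at p)" using s0 by simp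
  have "cos (pi * of_int k) \<noteq> (0::real)" using cos_pi_int_squared[of k] by auto
  then have nz: "complex_of_real (pi / h * cos (pi * of_int k)) \<noteq> 0" using \<open>0 < h\<close> by simp
  have "p \<noteq> of_real x" unfolding p_def of_real_eq_iff using assms(3) by (rule not_sym)
  then have "((\<lambda>w. g w / (w - of_real x) / (sin (of_real (pi / h) * w) / (w - p))) \<longlongrightarrow>
      g p / (p - of_real x) / of_real (pi / h * cos (pi * of_int k))) (at p)"
    using assms(2) nz by (intro tendsto_intros lim) (auto simp: isCont_def p_def)
  then have "((\<lambda>w. g w / ((w - of_real x) * sin (of_real (pi / h) * w)) * (w - p)) \<longlongrightarrow>
      g p / ((p - of_real x) * of_real (pi / h * cos (pi * of_int k)))) (at p)"
    by simp
  then show ?thesis unfolding p_def of_real_diff[symmetric] of_real_mult[symmetric] .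
qed

text \<open>The residue theorem for \<open>g \<zeta> / ((\<zeta> - x) sin (\<pi> \<zeta> / h))\<close> on a rectangle whose vertical sides
  pass halfway between two consecutive nodes.\<close>

lemma sinc_contour_integral:
  fixes g :: "complex \<Rightarrow> complex" and d \<delta> h x X :: real and m :: nat
  assumes holo: "g holomorphic_on strip d" and "0 < \<delta>" "\<delta> < d" and "0 < h"
    and X: "X = (real m + 1 / 2) * h" and "\<bar>x\<bar> < X"
    and x: "\<And>k::int. x \<noteq> of_int k * h"
  defines "F \<equiv> \<lambda>z. g z / ((z - of_real x) * sin (of_real (pi / h) * z))"
  shows "continuous_on (path_image (rectpath (Complex (- X) (- \<delta>)) (Complex X \<delta>))) F" (is ?cont)
    and "of_real (sin (pi * (x / h))) / (2 * of_real pi * \<i>) *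
        contour_integral (rectpath (Complex (- X) (- \<delta>)) (Complex X \<delta>)) F
      = g (of_real x) - (\<Sum>k=- int m..int m. g (of_real (of_int k * h)) * of_real (sinc_basis k h x))" (is ?eq)
proof -
  define node :: "int \<Rightarrow> complex" where "node k = of_real (of_int k * h)" for k
  define nodes where "nodes = node ` {- int m..int m}"
  define pts where "pts = insert (of_real x) nodes"
  \<comment> \<open>The open box \<open>S\<close> ends at the first nodes outside the contour, plus
    and minus \<open>(m + 1) * h\<close>, and leaves them out. Hence the only nodes in
    \<open>S\<close> are those with \<open>|k| \<le> m\<close>, all of which the contour
    encloses.\<close>
  define R where "R = (real m + 1) * h"
  define S where "S = box (Complex (- R) (- d)) (Complex R d)"
  define P where "P = rectpath (Complex (- X) (- \<delta>)) (Complex X \<delta>)"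
  have "X < R" "0 < X" using \<open>0 < h\<close> by (auto simp: X R_def)
  have S_iff: "z \<in> S \<longleftrightarrow> \<bar>Re z\<bar> < R \<and> \<bar>Im z\<bar> < d" for z
    by (auto simp: S_def in_box_complex_iff)
  have "finite pts" by (simp add: pts_def nodes_def)
  have inj: "inj node"
  proof (rule injI)
    fix j k assume "node j = node k"
    then have "real_of_int j * h = real_of_int k * h" unfolding node_def of_real_eq_iff .
    then show "j = k" using \<open>0 < h\<close> by simp
  qed
  have x_nodes: "of_real x \<notin> nodes"
  proof
    assume "of_real x \<in> nodes"
    then obtain k where "complex_of_real x = of_real (of_int k * h)" 
      unfolding nodes_def node_def by (rule imageE)
    then have "x = of_int k * h" unfolding of_real_eq_iff .
    with x show False by blast
  qed
  have node_inside: "\<bar>real_of_int k * h\<bar> < X" if "k \<in> {- int m..int m}" for k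
  proof -
    have "\<bar>real_of_int k\<bar> \<le> real m" using that by auto
    then show ?thesis using \<open>0 < h\<close> by (simp add: abs_mult X)
  qed
  have sin_zero: "z \<in> nodes" if zero: "sin (of_real (pi / h) * z) = 0" and "z \<in> S" for z
  proof -
    obtain k :: int where k: "of_real (pi / h) * z = of_real (of_int k * pi)"
      using zero unfolding sin_eq_0 by (rule exE)
    then have z: "z = node k" using \<open>0 < h\<close> by (simp add: node_def field_simps)
    with \<open>z \<in> S\<close> have "\<bar>real_of_int k\<bar> * h < (real m + 1) * h" using \<open>0 < h\<close>
      by (simp add: S_iff node_def R_def abs_mult)
    then have "\<bar>real_of_int k\<bar> < real m + 1" using \<open>0 < h\<close> by simp
    then have "k \<in> {- int m..int m}" by simp linarith
    then show ?thesis by (simp add: z nodes_def)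
  qed
  have g_S: "g holomorphic_on S"
    by (rule holomorphic_on_subset[OF holo]) (auto simp: S_iff strip_def)
  have F_holo: "F holomorphic_on S - pts"
    unfolding F_def
    by (intro holomorphic_intros holomorphic_on_subset[OF g_S])
      (auto simp: pts_def dest: sin_zero simp del: of_real_divide)
  have pts_box: "p \<in> box (Complex (- X) (- \<delta>)) (Complex X \<delta>)" if "p \<in> pts" for p
  proof -
    have "\<bar>Re p\<bar> < X \<and> Im p = 0"
      using that node_inside \<open>\<bar>x\<bar> < X\<close> by (auto simp: pts_def nodes_def node_def)
    then show ?thesis using \<open>0 < \<delta>\<close> by (auto simp: in_box_complex_iff)
  qed
  then have path: "path_image P \<subseteq> S - pts"
    using \<open>0 < X\<close> \<open>X < R\<close> \<open>0 < \<delta>\<close> \<open>\<delta> < d\<close> unfolding P_def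
    by (fastforce simp: path_image_rectpath_cbox_minus_box S_iff in_cbox_complex_iff)
  show ?cont
    using holomorphic_on_imp_continuous_on[OF F_holo] path
    unfolding P_def by (rule continuous_on_subset)
  have wind: "\<forall>z. z \<notin> S \<longrightarrow> winding_number P z = 0"
    using \<open>0 < X\<close> \<open>X < R\<close> \<open>0 < \<delta>\<close> \<open>\<delta> < d\<close> unfolding P_def
    by (auto intro!: winding_number_rectpath_outside simp: S_iff in_cbox_complex_iff)
  have "open S" "connected S" by (auto simp: S_def intro: convex_connected)
  have "contour_integral P F = 2 * pi * \<i> * (\<Sum>p\<in>pts. winding_number P p * residue F p)"
    using \<open>open S\<close> \<open>connected S\<close> \<open>finite pts\<close> F_holo path wind
    by (intro Residue_theorem) (auto simp: P_def)
  also have "(\<Sum>p\<in>pts. winding_number P p * residue F p) = (\<Sum>p\<in>pts. residue F p)"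
    using pts_box by (intro sum.cong) (auto simp: P_def winding_number_rectpath)
  also have "\<dots> = residue F (of_real x) + (\<Sum>k=- int m..int m. residue F (node k))"
    unfolding pts_def using x_nodes inj
    by (simp add: nodes_def sum.reindex inj_on_subset[OF inj])
  finally have int: "contour_integral P F =
      2 * pi * \<i> * (residue F (of_real x) + (\<Sum>k=- int m..int m. residue F (node k)))" .
  have sx: "sin (pi * (x / h)) \<noteq> 0"
  proof
    assume "sin (pi * (x / h)) = 0"
    then obtain k :: int where "pi * (x / h) = of_int k * pi" by (auto simp: sin_zero_iff_int2)
    then have "x = of_int k * h" using \<open>0 < h\<close> by (simp add: field_simps)
    with x show False by blast
  qed
  \<comment> \<open>Computing the residue at \<open>p\<close> takes an open set on which
    \<open>p\<close> is the only singularity; removing the finitely many other poles from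
    \<open>S\<close> provides it.\<close>
  have open_p: "open (S - (pts - {p}))" for p
    using \<open>open S\<close> \<open>finite pts\<close> by (intro open_Diff finite_imp_closed) auto
  have F_p: "F holomorphic_on S - (pts - {p}) - {p}" for p
    by (rule holomorphic_on_subset[OF F_holo]) auto
  have pts_S: "pts \<subseteq> S"
    using pts_box \<open>X < R\<close> \<open>\<delta> < d\<close> by (fastforce simp: S_iff in_box_complex_iff)
  have isCont_g: "isCont g p" if "p \<in> S" for p
    using holomorphic_on_imp_continuous_on[OF g_S] \<open>open S\<close> that
    by (simp add: continuous_on_eq_continuous_at)
  have sin_x: "sin (of_real (pi / h) * complex_of_real x) = of_real (sin (pi * (x / h)))"
    by (simp flip: sin_of_real)
  have res_x: "residue F (of_real x) = g (of_real x) / of_real (sin (pi * (x / h)))"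
  proof (rule residue_simple'[OF open_p[of "of_real x"] _ F_p])
    have "of_real x \<in> S" using pts_S by (simp add: pts_def)
    then show "of_real x \<in> S - (pts - {of_real x})" by simp
    have "((\<lambda>w. g w / sin (of_real (pi / h) * w)) \<longlongrightarrow>
        g (of_real x) / sin (of_real (pi / h) * of_real x)) (at (of_real x))"
      using isCont_g[OF \<open>of_real x \<in> S\<close>] sx sin_x
      by (intro tendsto_intros) (auto simp: isCont_def)
    then show "((\<lambda>w. F w * (w - of_real x)) \<longlongrightarrow> g (of_real x) / of_real (sin (pi * (x / h))))
        (at (of_real x))"
      unfolding sin_x
      by (rule Lim_transform_eventually) (auto simp: F_def eventually_at intro!: exI[of _ 1])
  qed
  have res_k: "residue F (node k) =
      g (node k) / of_real ((of_int k * h - x) * (pi / h * cos (pi * of_int k)))"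
    if "k \<in> {- int m..int m}" for k
  proof (rule residue_simple'[OF open_p[of "node k"] _ F_p])
    have "node k \<in> S" using pts_S that by (auto simp: pts_def nodes_def)
    then show "node k \<in> S - (pts - {node k})" by simp
    show "((\<lambda>w. F w * (w - node k)) \<longlongrightarrow>
        g (node k) / of_real ((of_int k * h - x) * (pi / h * cos (pi * of_int k)))) (at (node k))"
      using isCont_g[OF \<open>node k \<in> S\<close>] unfolding F_def node_def
      by (intro sinc_residue_tendsto) (use \<open>0 < h\<close> x in auto)
  qed
  \<comment> \<open>Here \<open>c\<close> is the sign \<open>(-1)^k\<close>, its own inverse, so it
    may pass from the denominator of the residue to the numerator of the sinc function. The minus
    sign comes from \<open>of_int k * h - x\<close> against \<open>x / h - of_int k\<close>.\<close>
  have term_k: "of_real (sin (pi * (x / h))) * residue F (node k) =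
      - (g (node k) * of_real (sinc_basis k h x))" if "k \<in> {- int m..int m}" for k
  proof -
    define c where "c = cos (pi * real_of_int k)"
    have c: "c * c = 1" using cos_pi_int_squared[of k] by (simp add: c_def power2_eq_square)
    then have "c \<noteq> 0" by auto
    have nz: "real_of_int k * h - x \<noteq> 0" using x[of k] by simp
    have "sinc_basis k h x = sin (pi * (x / h)) * c / (pi * (x / h - of_int k))"
      using x[of k] sin_pi_diff_int[of "x / h" k] by (simp add: sinc_basis_def c_def)
    also have "pi * (x / h - of_int k) = - (pi / h) * (of_int k * h - x)"
      using \<open>0 < h\<close> by (simp add: field_simps)
    also have "sin (pi * (x / h)) * c = sin (pi * (x / h)) / c"
      using c \<open>c \<noteq> 0\<close> by (simp add: eq_divide_eq mult.assoc)
    also have "sin (pi * (x / h)) / c / (- (pi / h) * (of_int k * h - x))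
        = - (sin (pi * (x / h)) / ((of_int k * h - x) * (pi / h * c)))"
      by (simp add: mult_ac)
    finally show ?thesis unfolding res_k[OF that] c_def by simp
  qed
  have "of_real (sin (pi * (x / h))) / (2 * of_real pi * \<i>) * contour_integral P F
      = of_real (sin (pi * (x / h))) * (residue F (of_real x) + (\<Sum>k=- int m..int m. residue F (node k)))"
  proof -
    have "a / u * (u * b) = a * b" if "u \<noteq> 0" for a b u :: complex using that by simp
    from this[of "2 * of_real pi * \<i>"] show ?thesis unfolding int by simp
  qed
  also have "\<dots> = g (of_real x) + (\<Sum>k=- int m..int m. of_real (sin (pi * (x / h))) * residue F (node k))"
    using sx by (simp add: distrib_left sum_distrib_left res_x)
  also have "(\<Sum>k=- int m..int m. of_real (sin (pi * (x / h))) * residue F (node k))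
      = - (\<Sum>k=- int m..int m. g (node k) * of_real (sinc_basis k h x))"
    using term_k by (simp add: sum_negf)
  finally show ?eq by (simp add: P_def node_def)
qed

section \<open>Error bounds for sinc interpolation on a strip\<close>

text \<open>The contour has height \<delta> below \<open>d\<close> because \<open>g\<close> is
  controlled only on the open strip. The margin \<open>1\<close> in \<open>|x| + 1 \<le> X\<close>
  keeps the vertical sides away from the pole at \<open>x\<close>. The two summands come from the
  horizontal and the vertical sides.\<close>

lemma norm_sinc_partial_sum_error_le:
  fixes g :: "complex \<Rightarrow> complex" and B d \<delta> h \<mu> x X :: real and m :: nat
  assumes holo: "g holomorphic_on strip d" and "0 < \<delta>" "\<delta> < d" and "0 < h" "0 < \<mu>"
    and bound: "\<And>z. z \<in> strip d \<Longrightarrow> norm (g z) \<le> B * exp (- \<mu> * \<bar>Re z\<bar>)"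
    and X: "X = (real m + 1 / 2) * h" and "\<bar>x\<bar> + 1 \<le> X"
  shows "norm (g (of_real x) - (\<Sum>k=- int m..int m. g (of_real (of_int k * h)) * of_real (sinc_basis k h x)))
    \<le> 2 * B / (pi * \<mu> * \<delta> * sinh (pi * \<delta> / h)) + 2 * \<delta> * B / pi * exp (- \<mu> * X)"
    (is "norm (?g - ?sum) \<le> ?bound")
proof -
  have "0 \<in> strip d" using \<open>0 < \<delta>\<close> \<open>\<delta> < d\<close> by (simp add: strip_def)
  from bound[OF this] have "0 \<le> B" using norm_ge_zero[of "g 0"] by (simp del: norm_ge_zero)
  define s where "s = sinh (pi * \<delta> / h)"
  have s: "0 < s" using \<open>0 < \<delta>\<close> \<open>0 < h\<close> by (simp add: s_def)
  have nonneg: "0 \<le> ?bound" using \<open>0 \<le> B\<close> \<open>0 < \<mu>\<close> \<open>0 < \<delta>\<close> s by (simp add: s_def)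
  show ?thesis
  proof (cases "\<exists>j::int. x = of_int j * h")
    case True
    then obtain j :: int where j: "x = of_int j * h" by blast
    have "\<bar>real_of_int j\<bar> * h < (real m + 1) * h"
      using \<open>\<bar>x\<bar> + 1 \<le> X\<close> \<open>0 < h\<close> by (simp add: j X abs_mult algebra_simps)
    then have "\<bar>real_of_int j\<bar> < real m + 1" using \<open>0 < h\<close> by simp
    then have "j \<in> {- int m..int m}" by simp linarith
    then have "?sum = g (of_real x)"
      unfolding j using \<open>0 < h\<close> by (simp add: sinc_basis_node if_distrib cong: if_cong)
    then show ?thesis using nonneg by simp
  next
    case False
    then have x: "\<And>k::int. x \<noteq> of_int k * h" by blast
    define F where "F z = g z / ((z - of_real x) * sin (of_real (pi / h) * z))" for z
    define P where "P = rectpath (Complex (- X) (- \<delta>)) (Complex X \<delta>)"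
    define V where "V = B * exp (- \<mu> * X)"
    define I where "I = B / (\<delta> * s) * (2 * (1 - exp (- \<mu> * X)) / \<mu>)"
    have "0 < X" "\<bar>x\<bar> < X" using \<open>\<bar>x\<bar> + 1 \<le> X\<close> by auto
    note contour = sinc_contour_integral[OF holo \<open>0 < \<delta>\<close> \<open>\<delta> < d\<close> \<open>0 < h\<close> X \<open>\<bar>x\<bar> < X\<close> x,
        folded F_def, folded P_def]
    have "((\<lambda>t. B / (\<delta> * s) * exp (- \<mu> * \<bar>t\<bar>)) has_integral I) {- X..X}"
      unfolding I_def using \<open>0 < \<mu>\<close> \<open>0 < X\<close>
      by (intro has_integral_mult_right has_integral_exp_minus_abs) auto
    moreover have horiz: "norm (F (Complex t y)) \<le> B / (\<delta> * s) * exp (- \<mu> * \<bar>t\<bar>)"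
      if "\<bar>y\<bar> = \<delta>" for t y
    proof -
      let ?z = "Complex t y"
      have "\<delta> \<le> norm (?z - of_real x)"
        using abs_Im_le_cmod[of "?z - of_real x"] that by simp
      moreover have "\<bar>Im (of_real (pi / h) * ?z)\<bar> = pi * \<delta> / h"
        using that \<open>0 < h\<close> by (simp add: abs_mult)
      then have "s \<le> norm (sin (of_real (pi / h) * ?z))"
        using sinh_le_norm_sin[of "of_real (pi / h) * ?z"] by (simp only: s_def)
      ultimately have "\<delta> * s \<le> norm ((?z - of_real x) * sin (of_real (pi / h) * ?z))"
        unfolding norm_mult using \<open>0 < \<delta>\<close> s by (intro mult_mono) auto
      moreover have "norm (g ?z) \<le> B * exp (- \<mu> * \<bar>t\<bar>)"
        using bound[of ?z] that \<open>\<delta> < d\<close> by (simp add: strip_def)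
      ultimately have "norm (F ?z) \<le> B * exp (- \<mu> * \<bar>t\<bar>) / (\<delta> * s)"
        unfolding F_def norm_divide using \<open>0 < \<delta>\<close> s \<open>0 \<le> B\<close> by (intro frac_le) auto
      then show ?thesis by simp
    qed
    moreover have vert: "norm (F (Complex u t)) \<le> V" if "\<bar>u\<bar> = X" "t \<in> {- \<delta>..\<delta>}" for u t
    proof -
      let ?z = "Complex u t"
      have "1 \<le> norm (?z - of_real x)"
        using abs_Re_le_cmod[of "?z - of_real x"] that \<open>\<bar>x\<bar> + 1 \<le> X\<close> by simp
      \<comment> \<open>Since \<open>X / h\<close> is a half-integer,
        \<open>2 * (pi / h) * X\<close> is an odd multiple of \<open>pi\<close>.\<close>
      moreover have "cos (2 * Re (of_real (pi / h) * ?z)) = - 1"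
      proof -
        have "cos (2 * Re (of_real (pi / h) * ?z)) = cos (2 * (pi / h) * u)" by (simp add: mult.assoc)
        also have "\<dots> = cos (2 * (pi / h) * X)"
          using that(1) by (metis abs_minus_cancel abs_if cos_minus mult_minus_right)
        also have "2 * (pi / h) * X = 2 * real m * pi + pi"
          using \<open>0 < h\<close> by (simp add: X field_simps)
        also have "cos (2 * real m * pi + pi) = - 1"
          unfolding cos_periodic_pi using cos_2npi[of m] by (simp add: mult_ac)
        finally show ?thesis .
      qed
      then have "1 \<le> norm (sin (of_real (pi / h) * ?z))" by (rule one_le_norm_sin)
      ultimately have "1 * 1 \<le> norm ((?z - of_real x) * sin (of_real (pi / h) * ?z))"
        unfolding norm_mult by (intro mult_mono) auto
      moreover have "norm (g ?z) \<le> V"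
        using bound[of ?z] that \<open>\<delta> < d\<close> by (auto simp: strip_def V_def)
      ultimately have "norm (F ?z) \<le> V / (1 * 1)"
        unfolding F_def norm_divide using \<open>0 \<le> B\<close> by (intro frac_le) (auto simp: V_def)
      then show ?thesis by simp
    qed
    ultimately have J: "norm (contour_integral P F) \<le> 2 * I + 4 * \<delta> * V"
      using contour(1) \<open>0 < X\<close> \<open>0 < \<delta>\<close> \<open>0 \<le> B\<close> unfolding P_def
      by (intro norm_contour_integral_rectpath_le) (auto simp: V_def)
    have "norm (?g - ?sum) = \<bar>sin (pi * (x / h))\<bar> / (2 * pi) * norm (contour_integral P F)"
      unfolding contour(2)[symmetric] by (simp add: norm_mult norm_divide)
    also have "\<dots> \<le> 1 / (2 * pi) * (2 * I + 4 * \<delta> * V)"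
      using J by (intro mult_mono divide_right_mono) auto
    also have "\<dots> = I / pi + 2 * \<delta> * B / pi * exp (- \<mu> * X)"
      by (simp add: V_def field_simps)
    \<comment> \<open>The integral of the majorant is enlarged to its value over the whole line,
      which removes the dependence on \<open>m\<close>.\<close>
    also have "I \<le> B / (\<delta> * s) * (2 * (1 - 0) / \<mu>)"
      unfolding I_def using \<open>0 \<le> B\<close> \<open>0 < \<delta>\<close> s \<open>0 < \<mu>\<close>
      by (intro mult_left_mono divide_right_mono diff_left_mono) auto
    then have "I / pi \<le> 2 * B / (pi * \<mu> * \<delta> * s)"
      by (simp add: field_simps)
    finally show ?thesis by (simp add: s_def)
  qed
qed

text \<open>Because \<open>q \<le> exp q - 1\<close>, each term is at most \<open>1 / q\<close>
  times the difference of two consecutive exponentials, and these differences telescope.\<close>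

lemma sum_exp_tail_le:
  fixes q :: real and N m :: int
  assumes "0 < q" and "N \<le> m"
  shows "(\<Sum>k\<in>{N<..m}. exp (- q * of_int k)) \<le> exp (- q * of_int N) / q"
proof -
  have "(\<Sum>k\<in>{N<..m}. exp (- q * of_int k)) \<le> (exp (- q * of_int N) - exp (- q * of_int m)) / q"
    using \<open>N \<le> m\<close>
  proof (induction m rule: int_ge_induct)
    case (step m)
    have "q * exp (- q * of_int (m + 1)) \<le> (exp q - 1) * exp (- q * of_int (m + 1))"
      using exp_ge_add_one_self[of q]
      by (intro mult_right_mono) (simp_all del: exp_ge_add_one_self)
    also have "\<dots> = exp (- q * of_int m) - exp (- q * of_int (m + 1))"
      by (simp add: left_diff_distrib flip: exp_add) (simp add: algebra_simps)
    finally have "exp (- q * of_int (m + 1)) \<le> (exp (- q * of_int m) - exp (- q * of_int (m + 1))) / q"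
      using \<open>0 < q\<close> by (simp add: field_simps)
    moreover have "{N<..m + 1} = insert (m + 1) {N<..m}" using step.hyps by auto
    ultimately show ?case using step.IH by (simp add: diff_divide_distrib)
  qed simp
  also have "\<dots> \<le> exp (- q * of_int N) / q"
    using \<open>0 < q\<close> by (intro divide_right_mono) auto
  finally show ?thesis .
qed

text \<open>The symmetric sum is compared with the truncated one at the price of two geometric
  tails. Then \<open>m\<close> tends to infinity, which removes the vertical sides, and after that
  \<delta> tends to \<open>d\<close>. The strip bound \<open>B\<close> enters only the contour part;
  the tails use the one-sided rates on the real line.\<close>

lemma norm_sinc_truncated_error_le:
  fixes g :: "complex \<Rightarrow> complex" and B K d h \<alpha> \<beta> \<mu> x :: real and M N :: int
  assumes holo: "g holomorphic_on strip d" and "0 < d" "0 < h" "0 < \<mu>" "0 < \<alpha>" "0 < \<beta>"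
    and "0 \<le> M" "0 \<le> N" "0 \<le> K"
    and bound: "\<And>z. z \<in> strip d \<Longrightarrow> norm (g z) \<le> B * exp (- \<mu> * \<bar>Re z\<bar>)"
    and left: "\<And>t. t \<le> 0 \<Longrightarrow> norm (g (of_real t)) \<le> K * exp (\<alpha> * t)"
    and right: "\<And>t. 0 \<le> t \<Longrightarrow> norm (g (of_real t)) \<le> K * exp (- \<beta> * t)"
  shows "norm (g (of_real x) - (\<Sum>k=-M..N. g (of_real (of_int k * h)) * of_real (sinc_basis k h x)))
    \<le> 2 * B / (pi * \<mu> * d * sinh (pi * d / h)) +
      K * (exp (- (\<alpha> * h) * of_int M) / (\<alpha> * h) + exp (- (\<beta> * h) * of_int N) / (\<beta> * h))"
    (is "?err \<le> ?D d + ?T")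
proof -
  define a where "a k = g (of_real (of_int k * h)) * of_real (sinc_basis k h x)" for k :: int
  have a_le: "norm (a k) \<le> norm (g (of_real (of_int k * h)))" for k
    using mult_left_mono[OF abs_sinc_basis_le_1[of k h x], of "norm (g (of_real (of_int k * h)))"]
    by (simp add: a_def norm_mult)
  have tail: "?err \<le> norm (g (of_real x) - (\<Sum>k=- int m..int m. a k)) + ?T"
    if "M \<le> int m" "N \<le> int m" for m
  proof -
    \<comment> \<open>The outer blocks are the omitted terms. The right one decays at rate \<beta>;
      the left one, after the reflection of \<open>k\<close> to \<open>- k\<close>, at rate
      \<alpha>.\<close>
    have "{- int m..int m} = ({- int m..<- M} \<union> {- M..N}) \<union> {N<..int m}"
      using that \<open>0 \<le> M\<close> \<open>0 \<le> N\<close> by auto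
    then have sum: "(\<Sum>k=- int m..int m. a k)
        = sum a {- int m..<- M} + sum a {- M..N} + sum a {N<..int m}"
      using \<open>0 \<le> M\<close> \<open>0 \<le> N\<close> by (simp add: sum.union_disjoint disjoint_iff)
    have "norm (sum a {N<..int m}) \<le> (\<Sum>k\<in>{N<..int m}. K * exp (- (\<beta> * h) * of_int k))"
    proof (rule sum_norm_le)
      fix k assume "k \<in> {N<..int m}"
      then have "0 \<le> real_of_int k * h" using \<open>0 \<le> N\<close> \<open>0 < h\<close> by simp
      from order_trans[OF a_le right[OF this]]
      show "norm (a k) \<le> K * exp (- (\<beta> * h) * of_int k)" by (simp add: mult_ac)
    qed
    also have "\<dots> = K * (\<Sum>k\<in>{N<..int m}. exp (- (\<beta> * h) * of_int k))"
      by (simp add: sum_distrib_left)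
    also have "\<dots> \<le> K * (exp (- (\<beta> * h) * of_int N) / (\<beta> * h))"
      using that \<open>0 < \<beta>\<close> \<open>0 < h\<close> \<open>0 \<le> K\<close> by (intro mult_left_mono sum_exp_tail_le) auto
    finally have r: "norm (sum a {N<..int m}) \<le> K * (exp (- (\<beta> * h) * of_int N) / (\<beta> * h))" .
    have "sum a {- int m..<- M} = (\<Sum>k\<in>{M<..int m}. a (- k))"
      by (rule sum.reindex_bij_witness[of _ uminus uminus]) auto
    also have "norm \<dots> \<le> (\<Sum>k\<in>{M<..int m}. K * exp (- (\<alpha> * h) * of_int k))"
    proof (rule sum_norm_le)
      fix k assume "k \<in> {M<..int m}"
      then have "real_of_int (- k) * h \<le> 0" using \<open>0 \<le> M\<close> \<open>0 < h\<close> by simp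
      from order_trans[OF a_le left[OF this]]
      show "norm (a (- k)) \<le> K * exp (- (\<alpha> * h) * of_int k)" by (simp add: mult_ac)
    qed
    also have "\<dots> = K * (\<Sum>k\<in>{M<..int m}. exp (- (\<alpha> * h) * of_int k))"
      by (simp add: sum_distrib_left)
    also have "\<dots> \<le> K * (exp (- (\<alpha> * h) * of_int M) / (\<alpha> * h))"
      using that \<open>0 < \<alpha>\<close> \<open>0 < h\<close> \<open>0 \<le> K\<close> by (intro mult_left_mono sum_exp_tail_le) auto
    finally have l: "norm (sum a {- int m..<- M}) \<le> K * (exp (- (\<alpha> * h) * of_int M) / (\<alpha> * h))" .
    have "g (of_real x) - sum a {- M..N} = (g (of_real x) - (\<Sum>k=- int m..int m. a k))
        + (sum a {- int m..<- M} + sum a {N<..int m})"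
      unfolding sum by simp
    then have "norm (g (of_real x) - sum a {- M..N})
      \<le> norm (g (of_real x) - (\<Sum>k=- int m..int m. a k)) + ?T"
      unfolding distrib_left by (metis norm_triangle_mono[OF order_refl norm_triangle_mono[OF l r]])
    then show ?thesis by (simp add: a_def)
  qed
  have \<delta>: "?err \<le> ?D \<delta> + ?T" if "0 < \<delta>" "\<delta> < d" for \<delta>
  proof -
    define X where "X m = (real m + 1 / 2) * h" for m :: nat
    have X_lim: "filterlim X at_top sequentially"
    proof -
      have "X = (\<lambda>m. h / 2 + h * real m)" by (simp add: X_def fun_eq_iff algebra_simps)
      then show ?thesis
        using filterlim_tendsto_add_at_top[OF tendsto_const
          filterlim_tendsto_pos_mult_at_top[OF tendsto_const \<open>0 < h\<close> filterlim_real_sequentially]]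
        by simp
    qed
    have "((\<lambda>m. exp (- \<mu> * X m)) \<longlongrightarrow> 0) sequentially"
      using \<open>0 < \<mu>\<close> by (intro filterlim_compose[OF exp_at_bot] 
          filterlim_tendsto_neg_mult_at_bot[OF tendsto_const _ X_lim]) auto
    then have "((\<lambda>m. ?D \<delta> + 2 * \<delta> * B / pi * exp (- \<mu> * X m) + ?T)
        \<longlongrightarrow> ?D \<delta> + 2 * \<delta> * B / pi * 0 + ?T) sequentially"
      by (intro tendsto_intros)
    moreover have "\<forall>\<^sub>F m in sequentially. ?err \<le> ?D \<delta> + 2 * \<delta> * B / pi * exp (- \<mu> * X m) + ?T"
      using eventually_ge_at_top[of "nat M"] eventually_ge_at_top[of "nat N"]
        filterlim_at_top[THEN iffD1, OF X_lim, rule_format, of "\<bar>x\<bar> + 1"]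
    proof eventually_elim
      case (elim m)
      then have "M \<le> int m" "N \<le> int m" by auto
      from tail[OF this] 
        norm_sinc_partial_sum_error_le[OF holo that \<open>0 < h\<close> \<open>0 < \<mu>\<close> bound X_def elim(3)]
      show ?case unfolding a_def by linarith
    qed
    ultimately have "?err \<le> ?D \<delta> + 2 * \<delta> * B / pi * 0 + ?T"
      by (intro tendsto_lowerbound) auto
    then show ?thesis by simp
  qed
  \<comment> \<open>The bound is continuous in the height at \<open>d\<close>, so the limit from the
    left reaches the full width without boundary values of \<open>g\<close>.\<close>
  have "((\<lambda>\<delta>. ?D \<delta> + ?T) \<longlongrightarrow> ?D d + ?T) (at_left d)"
    using \<open>0 < d\<close> \<open>0 < h\<close> \<open>0 < \<mu>\<close> by (intro tendsto_intros) auto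
  moreover have "\<forall>\<^sub>F \<delta> in at_left d. ?err \<le> ?D \<delta> + ?T"
    using eventually_at_left[OF \<open>0 < d\<close>] \<delta> \<open>0 < d\<close> by blast
  ultimately show ?thesis by (intro tendsto_lowerbound) auto
qed

section \<open>Sinc approximation on the half-line\<close>

text \<open>The sum \<open>1 + exp u\<close> dominates both of its terms, hence
  \<open>exp (max u 0)\<close>. It is used with \<open>u = - x\<close> for the exponent \<alpha> and
  with \<open>u = x\<close> for \<beta>.\<close>

lemma one_plus_exp_powr_le:
  fixes a c u :: real
  assumes "0 < c" "0 \<le> a"
  shows "(1 / ((1 + exp u) * c)) powr a \<le> exp (- a * max u 0) / c powr a"
proof -
  have "exp (max u 0) \<le> 1 + exp u" by (simp add: max_def)
  then have "1 / ((1 + exp u) * c) \<le> 1 / (exp (max u 0) * c)"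
    using assms by (intro divide_left_mono mult_right_mono mult_pos_pos add_pos_pos) auto
  also have "\<dots> = exp (- max u 0) / c" by (simp add: exp_minus divide_inverse)
  finally have "(1 / ((1 + exp u) * c)) powr a \<le> (exp (- max u 0) / c) powr a"
    using assms by (intro powr_mono2) (auto intro!: divide_nonneg_nonneg mult_nonneg_nonneg add_nonneg_nonneg)
  also have "\<dots> = exp (- a * max u 0) / c powr a"
    using assms by (simp add: powr_divide exp_powr_real mult.commute)
  finally show ?thesis .
qed

text \<open>The lower bound \<open>c\<close> for the cosine is left free for two uses:
  \<open>cos (d / 2)\<close> uniformly on the strip, and \<open>1\<close> on the real line, where
  the tails then carry the plain constant \<open>K\<close>.\<close>

lemma norm_f_phi_le:
  fixes f :: "complex \<Rightarrow> complex" and x y c K \<alpha> \<beta> :: real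
  defines "w \<equiv> phi (Complex x y)"
  assumes "norm (f w) \<le> K * norm (w / (1 + w)) powr \<alpha> * norm (exp (- w)) powr \<beta>"
    and "\<bar>y\<bar> < pi" and "0 < c" "c \<le> cos (y / 2)" and "0 \<le> K" "0 \<le> \<alpha>" "0 \<le> \<beta>"
  shows "norm (f w) \<le> K / c powr (\<alpha> + \<beta>) * (exp (- \<alpha> * max (- x) 0) * exp (- \<beta> * max x 0))"
proof -
  have mono: "1 / ((1 + exp u) * cos (y / 2)) \<le> 1 / ((1 + exp u) * c)" for u :: real
    using \<open>0 < c\<close> \<open>c \<le> cos (y / 2)\<close> by (intro divide_left_mono mult_left_mono mult_pos_pos add_pos_pos)
      (auto intro: add_nonneg_nonneg)
  have "norm (w / (1 + w)) powr \<alpha> \<le> (1 / ((1 + exp (- x)) * c)) powr \<alpha>"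
    using order_trans[OF norm_phi_ratio_le[OF \<open>\<bar>y\<bar> < pi\<close>, of x] mono[of "- x"]] \<open>0 \<le> \<alpha>\<close>
    unfolding w_def by (intro powr_mono2) auto
  also have "\<dots> \<le> exp (- \<alpha> * max (- x) 0) / c powr \<alpha>"
    using \<open>0 < c\<close> \<open>0 \<le> \<alpha>\<close> by (rule one_plus_exp_powr_le)
  finally have a: "norm (w / (1 + w)) powr \<alpha> \<le> exp (- \<alpha> * max (- x) 0) / c powr \<alpha>" .
  have "norm (exp (- w)) powr \<beta> \<le> (1 / ((1 + exp x) * c)) powr \<beta>"
    using order_trans[OF norm_exp_minus_phi_le[OF \<open>\<bar>y\<bar> < pi\<close>, of x] mono[of x]] \<open>0 \<le> \<beta>\<close>
    unfolding w_def by (intro powr_mono2) auto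
  also have "\<dots> \<le> exp (- \<beta> * max x 0) / c powr \<beta>"
    using \<open>0 < c\<close> \<open>0 \<le> \<beta>\<close> by (rule one_plus_exp_powr_le)
  finally have b: "norm (exp (- w)) powr \<beta> \<le> exp (- \<beta> * max x 0) / c powr \<beta>" .
  have "norm (f w) \<le> K * (norm (w / (1 + w)) powr \<alpha> * norm (exp (- w)) powr \<beta>)"
    using assms(2) by (simp add: mult.assoc)
  also have "\<dots> \<le> K * (exp (- \<alpha> * max (- x) 0) / c powr \<alpha> * (exp (- \<beta> * max x 0) / c powr \<beta>))"
    using \<open>0 \<le> K\<close> by (intro mult_left_mono mult_mono a b) auto
  also have "\<dots> = K / c powr (\<alpha> + \<beta>) * (exp (- \<alpha> * max (- x) 0) * exp (- \<beta> * max x 0))"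
    by (simp add: powr_add)
  finally show ?thesis .
qed

lemma phi_phi_inv:
  assumes "0 < t"
  shows "phi (of_real (phi_inv t)) = of_real t"
proof -
  have "exp (phi_inv t) = exp t - 1" using assms by (simp add: phi_inv_def)
  then have "1 + exp (complex_of_real (phi_inv t)) = of_real (exp t)"
    by (simp add: exp_of_real)
  then show ?thesis by (simp add: phi_def Ln_of_real)
qed

text \<open>Write \<open>sinh (s * r)\<close> as
  \<open>exp (s * r) * (1 - exp (- 2 * (s * r))) / 2\<close> and use \<open>s \<le> s * r\<close> in
  the bracket. Multiplying by \<open>E\<close> and \<open>r\<close>, both at least \<open>1\<close>,
  gives the shape of the constant \<open>C\<close>.\<close>

lemma strip_discretization_constant_le:
  fixes B E s r :: real
  assumes "0 \<le> B" "0 < s" "1 \<le> r" "1 \<le> E"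
  shows "2 * B / (s\<^sup>2 * sinh (s * r)) \<le> 4 * B / (s\<^sup>2 * (1 - exp (- 2 * s))) * E * r * exp (- (s * r))"
proof -
  have sinh: "sinh (s * r) = exp (s * r) * (1 - exp (- 2 * (s * r))) / 2"
    by (simp add: sinh_def right_diff_distrib flip: exp_add)
  have "s \<le> s * r" using assms by simp
  then have "1 - exp (- 2 * s) \<le> 1 - exp (- 2 * (s * r))" by simp
  moreover have pos: "0 < 1 - exp (- 2 * s)" using assms by simp
  moreover have "2 * B / (s\<^sup>2 * sinh (s * r)) = 4 * B * exp (- (s * r)) / (s\<^sup>2 * (1 - exp (- 2 * (s * r))))"
    unfolding sinh by (simp add: exp_minus field_simps)
  ultimately have "2 * B / (s\<^sup>2 * sinh (s * r)) \<le> 4 * B * exp (- (s * r)) / (s\<^sup>2 * (1 - exp (- 2 * s)))"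
    using assms by (auto intro!: divide_left_mono mult_left_mono mult_pos_pos)
  also have "\<dots> = 4 * B / (s\<^sup>2 * (1 - exp (- 2 * s))) * exp (- (s * r)) * (1 * 1)" by simp
  also have "\<dots> \<le> 4 * B / (s\<^sup>2 * (1 - exp (- 2 * s))) * exp (- (s * r)) * (E * r)"
    using assms pos by (intro mult_left_mono mult_mono) auto
  finally show ?thesis by (simp add: mult_ac)
qed

theorem theorem2p2:
  fixes f :: "complex \<Rightarrow> complex"
    and d K \<alpha> \<beta> \<mu> h C :: real
    and n :: nat
    and M N :: int
  assumes "0 < d" and "d < pi"
    and "f analytic_on phi ` strip d"
    and "0 < K" and "0 < \<alpha>" and "0 < \<beta>"
    and "\<And>z. z \<in> phi ` strip d \<Longrightarrow>
           norm (f z) \<le> K * norm (z / (1 + z)) powr \<alpha> * norm (exp (- z)) powr \<beta>"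
    and "\<mu> = min \<alpha> \<beta>"
    and "0 < n"
    and "\<mu> = \<alpha> \<Longrightarrow> M = int n \<and> N = \<lceil>\<alpha> * real n / \<beta>\<rceil>"
    and "\<mu> = \<beta> \<Longrightarrow> N = int n \<and> M = \<lceil>\<beta> * real n / \<alpha>\<rceil>"
    and "h = sqrt (pi * d / (\<mu> * real n))"
    and "C = 2 * K / sqrt (pi * d * \<mu>) *
           (2 / (sqrt (pi * d * \<mu>) * (1 - exp (- 2 * sqrt (pi * d * \<mu>))) *
                 cos (d / 2) powr (\<alpha> + \<beta>)) *
              (exp 1 / (exp 1 - 1)) powr (\<mu> / 2) + 1)"
  shows "(SUP t\<in>{0<..}. ereal (norm (f (complex_of_real t) -
            (\<Sum>k=-M..N. f (phi (complex_of_real (real_of_int k * h))) *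
                       complex_of_real (sinc_basis k h (phi_inv t))))))
         \<le> ereal (C * sqrt (real n) * exp (- sqrt (pi * d * \<mu> * real n)))"
proof -
  define g where "g z = f (phi z)" for z
  define c where "c = cos (d / 2)"
  \<comment> \<open>In terms of \<open>s\<close> and \<open>r\<close> the step is
    \<open>h = s / (\<mu> * r)\<close>, and both \<open>pi * d / h\<close> and
    \<open>\<mu> * n * h\<close> equal \<open>s * r\<close>. So the contour error and the tails
    decay with the same exponent.\<close>
  define s where "s = sqrt (pi * d * \<mu>)"
  define r where "r = sqrt (real n)"
  define B where "B = K / c powr (\<alpha> + \<beta>)"
  define E where "E = (exp 1 / (exp 1 - 1)) powr (\<mu> / 2 :: real)"
  note d = \<open>0 < d\<close> \<open>d < pi\<close> and pos = \<open>0 < K\<close> \<open>0 < \<alpha>\<close> \<open>0 < \<beta>\<close>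
  have \<mu>: "0 < \<mu>" "\<mu> \<le> \<alpha>" "\<mu> \<le> \<beta>" using assms by auto
  have c: "0 < c" using cos_half_pos[of d] d by (simp add: c_def)
  have "0 < s" using \<mu> d by (simp add: s_def)
  have "1 \<le> r" using \<open>0 < n\<close> by (simp add: r_def)
  have s2: "s\<^sup>2 = pi * d * \<mu>" and r2: "r\<^sup>2 = real n" using \<mu> d by (simp_all add: s_def r_def)
  have sr: "sqrt (pi * d * \<mu> * real n) = s * r" by (simp add: s_def r_def real_sqrt_mult)
  have h: "h = s / (\<mu> * r)"
  proof -
    have "pi * d / (\<mu> * real n) = (s / (\<mu> * r))\<^sup>2"
      unfolding power_divide power_mult_distrib s2 r2 using \<mu> by (simp add: power2_eq_square)
    then show ?thesis using assms(12) \<open>0 < s\<close> \<open>1 \<le> r\<close> \<mu> by (simp add: real_sqrt_unique)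
  qed
  have "0 < h" using h \<open>0 < s\<close> \<open>1 \<le> r\<close> \<mu> by simp
  have pdh: "pi * d / h = s * r"
    using s2 \<open>0 < s\<close> \<open>1 \<le> r\<close> \<mu> by (simp add: h field_simps power2_eq_square)
  have "0 \<le> B" using \<open>0 < K\<close> by (simp add: B_def)
  have "1 \<le> E"
  proof -
    have "1 < exp (1::real)" by simp
    then have "1 \<le> exp 1 / (exp 1 - 1 :: real)" by (simp add: field_simps)
    then show ?thesis using \<mu> by (simp add: E_def ge_one_powr_ge_zero)
  qed
  \<comment> \<open>On the side with the smaller exponent this is an equality; on the other side the
    ceiling rounds the number of terms up, so both tails decay at least like
    \<open>exp (- \<mu> * n * h)\<close>.\<close>
  have MN: "0 \<le> M" "0 \<le> N" "\<mu> * real n \<le> \<alpha> * of_int M" "\<mu> * real n \<le> \<beta> * of_int N"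
  proof -
    have "0 \<le> M \<and> 0 \<le> N \<and> \<mu> * real n \<le> \<alpha> * of_int M \<and> \<mu> * real n \<le> \<beta> * of_int N"
    proof (cases "\<alpha> \<le> \<beta>")
      case True
      then have \<mu>\<alpha>: "\<mu> = \<alpha>" using assms(8) by simp
      then have MN: "M = int n" "N = \<lceil>\<alpha> * real n / \<beta>\<rceil>" using assms(10) by auto
      have 1: "\<alpha> * real n / \<beta> \<le> of_int N" unfolding MN by (rule le_of_int_ceiling)
      have "0 \<le> \<alpha> * real n / \<beta>" using pos by simp
      then have "0 \<le> N" using 1 by linarith
      then show ?thesis using 1 pos \<mu>\<alpha> MN(1) by (simp add: field_simps)
    next
      case False
      then have \<mu>\<beta>: "\<mu> = \<beta>" using assms(8) by simp
      then have MN: "N = int n" "M = \<lceil>\<beta> * real n / \<alpha>\<rceil>" using assms(11) by auto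
      have 1: "\<beta> * real n / \<alpha> \<le> of_int M" unfolding MN by (rule le_of_int_ceiling)
      have "0 \<le> \<beta> * real n / \<alpha>" using pos by simp
      then have "0 \<le> M" using 1 by linarith
      then show ?thesis using 1 pos \<mu>\<beta> MN(1) by (simp add: field_simps)
    qed
    then show "0 \<le> M" "0 \<le> N" "\<mu> * real n \<le> \<alpha> * of_int M" "\<mu> * real n \<le> \<beta> * of_int N" by auto
  qed
  have holo: "g holomorphic_on strip d"
    unfolding g_def using holomorphic_on_compose[OF phi_holomorphic_on_strip analytic_imp_holomorphic[OF assms(3)]] d
    by (simp add: o_def)
  have decay: "norm (g z) \<le> B * exp (- \<mu> * \<bar>Re z\<bar>)" if "z \<in> strip d" for z
  proof -
    obtain x y where z: "z = Complex x y" by (cases z)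
    have "\<bar>y\<bar> < d" using that by (simp add: strip_def z)
    \<comment> \<open>The cosine decreases on \<open>[0, pi]\<close>, so its least value at
      half-heights within the strip is controlled by the boundary height \<open>d\<close>.\<close>
    have "c \<le> cos \<bar>y / 2\<bar>"
      unfolding c_def using \<open>\<bar>y\<bar> < d\<close> d by (intro cos_monotone_0_pi_le) auto
    then have "c \<le> cos (y / 2)" by (simp only: cos_abs_real)
    then have "norm (g z) \<le> B * (exp (- \<alpha> * max (- x) 0) * exp (- \<beta> * max x 0))"
      using assms(7)[of "phi z"] that \<open>\<bar>y\<bar> < d\<close> d pos c unfolding B_def g_def z
      by (intro norm_f_phi_le) auto
    \<comment> \<open>At most one of the two maxima is nonzero, so lowering both rates to \<mu>
      leaves \<open>exp (- \<mu> * |x|)\<close>.\<close>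
    also have "exp (- \<alpha> * max (- x) 0) * exp (- \<beta> * max x 0) \<le> exp (- \<mu> * max (- x) 0) * exp (- \<mu> * max x 0)"
      using \<mu> by (intro mult_mono) (auto intro!: mult_right_mono)
    also have "\<dots> = exp (- \<mu> * \<bar>Re z\<bar>)"
      by (simp add: z max_def flip: exp_add)
    finally show ?thesis using \<open>0 \<le> B\<close> by (simp add: mult_left_mono)
  qed
  have decay_real: "norm (g (of_real t)) \<le> K * (exp (- \<alpha> * max (- t) 0) * exp (- \<beta> * max t 0))" for t
    using norm_f_phi_le[of f t 0 K \<alpha> \<beta> 1] assms(7)[of "phi (of_real t)"] pos d
    by (simp add: g_def complex_of_real_def strip_def)
  \<comment> \<open>Each tail is at most \<open>K * exp (- (s * r)) / (\<mu> * h)\<close>, and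
    \<open>\<mu> * h = s / r\<close> produces the factor \<open>sqrt n\<close> and the summand
    \<open>1\<close> in \<open>C\<close>.\<close>
  have trunc: "K * (exp (- (\<alpha> * h) * of_int M) / (\<alpha> * h) + exp (- (\<beta> * h) * of_int N) / (\<beta> * h))
    \<le> 2 * K / s * r * exp (- (s * r))"
  proof -
    have "\<mu> * real n * h = s * r"
      unfolding r2[symmetric] h using \<mu> \<open>1 \<le> r\<close> by (simp add: power2_eq_square)
    then have e: "exp (- (a * h) * of_int k) / (a * h) \<le> exp (- (s * r)) / (\<mu> * h)"
      if "\<mu> \<le> a" "\<mu> * real n \<le> a * of_int k" for a k
      using mult_right_mono[OF that(2), of h] that(1) \<mu> \<open>0 < h\<close>
      by (intro frac_le mult_right_mono) (auto simp: mult_ac)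
    have "K * (exp (- (\<alpha> * h) * of_int M) / (\<alpha> * h) + exp (- (\<beta> * h) * of_int N) / (\<beta> * h))
      \<le> K * (exp (- (s * r)) / (\<mu> * h) + exp (- (s * r)) / (\<mu> * h))"
      using pos \<mu> MN by (intro mult_left_mono add_mono e) auto
    also have "\<mu> * h = s / r" using \<mu> by (simp add: h)
    finally show ?thesis by (simp add: mult_ac)
  qed
  have "norm (f (of_real t) - (\<Sum>k=-M..N. f (phi (of_real (of_int k * h))) *
      of_real (sinc_basis k h (phi_inv t)))) \<le> C * sqrt (real n) * exp (- sqrt (pi * d * \<mu> * real n))"
    if "0 < t" for t
  proof -
    have "norm (g (of_real (phi_inv t)) - (\<Sum>k=-M..N. g (of_real (of_int k * h)) *
        of_real (sinc_basis k h (phi_inv t)))) \<le> 2 * B / (pi * \<mu> * d * sinh (pi * d / h)) +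
      K * (exp (- (\<alpha> * h) * of_int M) / (\<alpha> * h) + exp (- (\<beta> * h) * of_int N) / (\<beta> * h))"
    proof (rule norm_sinc_truncated_error_le[OF holo _ _ _ _ _ _ _ _ decay])
      show "norm (g (of_real u)) \<le> K * exp (\<alpha> * u)" if "u \<le> 0" for u
        using decay_real[of u] that by (cases "u = 0") (auto simp: max_def)
      show "norm (g (of_real u)) \<le> K * exp (- \<beta> * u)" if "0 \<le> u" for u
        using decay_real[of u] that by (cases "u = 0") (auto simp: max_def)
    qed (use d pos \<mu> MN \<open>0 < h\<close> in auto)
    also have "pi * \<mu> * d * sinh (pi * d / h) = s\<^sup>2 * sinh (s * r)"
      by (simp add: s2 pdh)
    also have "2 * B / (s\<^sup>2 * sinh (s * r)) +
      K * (exp (- (\<alpha> * h) * of_int M) / (\<alpha> * h) + exp (- (\<beta> * h) * of_int N) / (\<beta> * h))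
      \<le> 4 * B / (s\<^sup>2 * (1 - exp (- 2 * s))) * E * r * exp (- (s * r)) + 2 * K / s * r * exp (- (s * r))"
      using \<open>0 \<le> B\<close> \<open>0 < s\<close> \<open>1 \<le> r\<close> \<open>1 \<le> E\<close>
      by (intro add_mono strip_discretization_constant_le trunc)
    also have "\<dots> = 2 * K / s * (2 / (s * (1 - exp (- 2 * s)) * c powr (\<alpha> + \<beta>)) * E + 1) * r * exp (- (s * r))"
      by (simp add: B_def power2_eq_square algebra_simps)
    also have "\<dots> = C * sqrt (real n) * exp (- sqrt (pi * d * \<mu> * real n))"
      unfolding assms(13) sr by (simp only: s_def c_def E_def r_def)
    finally show ?thesis using that by (simp add: g_def phi_phi_inv)
  qed
  \<comment> \<open>The supremum is taken in \<open>ereal\<close>, so the pointwise bound is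
    enough.\<close>
  then show ?thesis by (intro SUP_least) simp
qed

end
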